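(* Let $\rho\in(0,1)$ and, for $n\ge1$ and $0\le r\le n$, let $$V_{n,\rho}(r)=\frac{\rho}{n}\sum_{j=r+1}^{n}\ \prod_{k=r+1}^{j-1}\left(1-\frac{\rho}{k}\right).$$ Let $\Delta_{n,\rho}(r)=V_{n,\rho}(r)-V_{n,\rho}(r-1)$ and $D_{n,\rho}(r)=\frac{n^2}{\rho}\Delta_{n,\rho}(r)$ for $1\le r\le n$, and put $$\ell_\rho=\rho^{1/(1-\rho)},\qquad c_\rho=\frac{\rho(1-\ell_\rho)}{2}.$$ Then for every $n$ the sequence $\{V_{n,\rho}(r)\}_{r=0}^n$ is unimodal; $0<c_\rho<\frac12$; and, uniformly for bounded $u$ such that $\ell_\rho n+u$ is an integer in $\{1,\dots,n\}$, $$D_{n,\rho}(\ell_\rho n+u)=-\frac1{\ell_\rho}\left(u-c_\rho\right)+O(n^{-1})\qquad(n\to\infty).$$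
   Context: Empty sums are $0$ and empty products are $1$. A finite sequence $\{V(r)\}_{r=0}^n$ is unimodal if there exist $0\le a\le b\le n$ with $V(0)\le\cdots\le V(a)=\cdots=V(b)\ge\cdots\ge V(n)$. "Uniformly for bounded $u$" means: for each $M>0$ there are $K,n_0$ such that the error is at most $K/n$ for all $n\ge n_0$ and all $u$ with $|u|\le M$ and $\ell_\rho n+u\in\{1,\dots,n\}$ an integer. Model (secretary problem with uncertain employment): $n$ applicants arrive in uniformly random order, each independently accepts an offer with probability $\rho$; the rule with threshold $r$ rejects the first $r$ applicants and then makes an offer to each subsequent record until an offer is accepted; $V_{n,\rho}(r)$ is the probability that the overall best applicant is hired. *)

theory Defs
  imports Complex_Main
begin

definition unimodal :: "nat \<Rightarrow> (nat \<Rightarrow> real) \<Rightarrow> bool" where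
  "unimodal n V \<longleftrightarrow>
     (\<exists>a b. a \<le> b \<and> b \<le> n \<and>
        (\<forall>i<a. V i \<le> V (Suc i)) \<and>
        (\<forall>i\<in>{a..<b}. V i = V (Suc i)) \<and>
        (\<forall>i\<in>{b..<n}. V i \<ge> V (Suc i)))"

text \<open>The success probability of the threshold rule, given by its closed formula. In the sum
  \<open>j \<ge> 1\<close>, so the truncated subtraction \<open>j - 1\<close> is exact.\<close>

definition Vseq :: "nat \<Rightarrow> real \<Rightarrow> nat \<Rightarrow> real" where
  "Vseq n \<rho> r = \<rho> / real n * (\<Sum>j=r+1..n. \<Prod>k=r+1..j-1. (1 - \<rho> / real k))"

text \<open>Meaningful only for \<open>1 \<le> r \<le> n\<close>, because of the subtraction on the naturals.\<close>

definition Delta :: "nat \<Rightarrow> real \<Rightarrow> nat \<Rightarrow> real" where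
  "Delta n \<rho> r = Vseq n \<rho> r - Vseq n \<rho> (r - 1)"

definition Dseq :: "nat \<Rightarrow> real \<Rightarrow> nat \<Rightarrow> real" where
  "Dseq n \<rho> r = (real n)\<^sup>2 / \<rho> * Delta n \<rho> r"

definition ell :: "real \<Rightarrow> real" where
  "ell \<rho> = \<rho> powr (1 / (1 - \<rho>))"

definition cconst :: "real \<Rightarrow> real" where
  "cconst \<rho> = \<rho> * (1 - ell \<rho>) / 2"

end

theory Submission
  imports Defs "HOL-Real_Asymp.Real_Asymp"
begin

text \<open>Writing \<open>P(r) = \<Prod>k=r+1..n. (1 - \<rho>/k)\<close>, the sum defining the success probability collapses to
  \<open>(n P(r) - r) / (1 - \<rho>)\<close>, so that \<open>D(r) = n / (1 - \<rho>) * (\<rho> n P(r) / r - 1)\<close>.  Since \<open>P(r) / r\<close>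
  decreases, the differences change sign at most once, which is unimodality.  For the expansion,
  \<open>ln P(r) = \<rho> ln (r/n) + c/r - c/n + O(n / r^3)\<close> with \<open>c = \<rho>(1 - \<rho>)/2\<close>, and \<open>\<ell>\<close> is the
  ratio \<open>r/n\<close> at which \<open>\<rho> (n/r) (r/n)^\<rho> = 1\<close>.\<close>

section \<open>Closed forms for the success probability and its differences\<close>

lemma sum_prod_closed_form:
  fixes \<rho> :: real
  assumes "r \<le> n"
  shows "(1 - \<rho>) * (\<Sum>j=r+1..n. \<Prod>k=r+1..j-1. (1 - \<rho> / real k))
    = real n * (\<Prod>k=r+1..n. (1 - \<rho> / real k)) - real r"
  using assms
proof (induction n rule: dec_induct)
  case base
  show ?case by simp
next
  case (step n)
  let ?P = "\<Prod>k=r+1..n. (1 - \<rho> / real k)"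
  \<comment> \<open>Passing to \<open>Suc n\<close> adds exactly the old product \<open>?P\<close>
    to the sum. Clearing the denominator of the new factor shows that the right side grows by the
    matching \<open>(1 - \<rho>) * ?P\<close>.\<close>
  have "real (Suc n) * (?P * (1 - \<rho> / real (Suc n))) = (real n + 1 - \<rho>) * ?P"
    by (simp add: field_simps)
  then show ?case
    using step by (simp add: algebra_simps)
qed

lemma Vseq_closed_form:
  assumes "\<rho> < 1" "r \<le> n"
  shows "Vseq n \<rho> r
    = \<rho> / (real n * (1 - \<rho>)) * (real n * (\<Prod>k=r+1..n. (1 - \<rho> / real k)) - real r)"
  unfolding Vseq_def sum_prod_closed_form[OF assms(2), of \<rho>, symmetric]
  using assms(1) by simp

text \<open>Neighbouring tail products satisfy \<open>P(r-1) = (1 - \<rho>/r) P(r)\<close>, so their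
  difference is \<open>\<rho> P(r) / r\<close>, a multiple of a single product; the shift of the
  subtracted \<open>r\<close> contributes the \<open>-1\<close>.\<close>

lemma Delta_closed_form:
  assumes "\<rho> < 1" "1 \<le> r" "r \<le> n"
  shows "Delta n \<rho> r
    = \<rho> / (real n * (1 - \<rho>)) * (\<rho> * real n * (\<Prod>k=r+1..n. (1 - \<rho> / real k)) / real r - 1)"
proof -
  obtain s where r: "r = Suc s" using assms(2) by (cases r) auto
  have "(\<Prod>k=s+1..n. (1 - \<rho> / real k))
      = (1 - \<rho> / real r) * (\<Prod>k=r+1..n. (1 - \<rho> / real k))"
    using prod.atLeast_Suc_atMost[of r n "\<lambda>k. 1 - \<rho> / real k"] assms(3) r by simp
  then have *: "(\<Prod>k=s+1..n. (1 - \<rho> / real k))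
      = (\<Prod>k=r+1..n. (1 - \<rho> / real k)) - \<rho> / real r * (\<Prod>k=r+1..n. (1 - \<rho> / real k))"
    by (simp only: left_diff_distrib mult_1_left)
  have "(real n * (\<Prod>k=r+1..n. (1 - \<rho> / real k)) - real r)
      - (real n * (\<Prod>k=s+1..n. (1 - \<rho> / real k)) - real s)
    = \<rho> * real n * (\<Prod>k=r+1..n. (1 - \<rho> / real k)) / real r - 1"
    unfolding * using r by (simp add: algebra_simps)
  moreover have "Delta n \<rho> r = \<rho> / (real n * (1 - \<rho>))
    * ((real n * (\<Prod>k=r+1..n. (1 - \<rho> / real k)) - real r)
      - (real n * (\<Prod>k=s+1..n. (1 - \<rho> / real k)) - real s))"
    using Vseq_closed_form[of \<rho> r n] Vseq_closed_form[of \<rho> s n] assms r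
    unfolding Delta_def by (simp only: right_diff_distrib) simp
  ultimately show ?thesis by simp
qed

section \<open>Unimodality from a single sign change\<close>

lemma unimodalI_sign_change:
  assumes "\<And>i. Suc i < n \<Longrightarrow> V (Suc i) \<le> V i \<Longrightarrow> V (Suc (Suc i)) \<le> V (Suc i)"
  shows "unimodal n V"
proof -
  \<comment> \<open>The first index at which the sequence fails to rise strictly; the alternative
    \<open>i = n\<close> guarantees that such an index exists when the sequence rises
    throughout.\<close>
  define a where "a = (LEAST i. i = n \<or> V (Suc i) \<le> V i)"
  have a: "a = n \<or> V (Suc a) \<le> V a"
    unfolding a_def by (rule LeastI[of _ n]) simp
  have "a \<le> n" unfolding a_def by (rule Least_le) simp
  moreover have "V i \<le> V (Suc i)" if "i < a" for i
    using not_less_Least[of i "\<lambda>i. i = n \<or> V (Suc i) \<le> V i"] that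
    unfolding a_def by force
  moreover have "V (Suc i) \<le> V i" if "a \<le> i" "i < n" for i
    using that
  proof (induction i rule: dec_induct)
    case base
    then show ?case using a by auto
  next
    case (step i)
    then show ?case using assms[of i] by auto
  qed
  \<comment> \<open>Both plateau endpoints are \<open>a\<close>, so the middle range is empty; a
    genuine plateau at the top is absorbed into the weakly decreasing part.\<close>
  ultimately show ?thesis unfolding unimodal_def by (intro exI[of _ a]) auto
qed

lemma prod_pos_of_lt_one:
  fixes \<rho> :: real
  assumes "\<rho> < 1"
  shows "0 < (\<Prod>k=r+1..n. (1 - \<rho> / real k))"
  using assms by (intro prod_pos) (auto simp: field_simps)

text \<open>The difference at \<open>r\<close> has the sign of \<open>\<rho> n P(r) / r - 1\<close>.
  Replacing \<open>r\<close> by \<open>r + 1\<close> multiplies the quotient \<open>P(r) / r\<close>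
  by \<open>r / (r + 1 - \<rho>)\<close>, which is below 1, so a nonpositive difference is followed
  by a nonpositive one.\<close>

lemma unimodal_Vseq:
  assumes "0 < \<rho>" "\<rho> < 1"
  shows "unimodal n (Vseq n \<rho>)"
proof (rule unimodalI_sign_change)
  fix i assume i: "Suc i < n" and le: "Vseq n \<rho> (Suc i) \<le> Vseq n \<rho> i"
  define P where "P r = (\<Prod>k=r+1..n. (1 - \<rho> / real k))" for r
  have n: "real n > 0" using i by simp
  have fac: "\<rho> / (real n * (1 - \<rho>)) > 0" using assms n by simp
  have sgn: "Vseq n \<rho> (Suc s) \<le> Vseq n \<rho> s \<longleftrightarrow> \<rho> * real n * P (Suc s) \<le> real (Suc s)"
    if "Suc s \<le> n" for s
  proof -
    have "Vseq n \<rho> (Suc s) - Vseq n \<rho> s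
        = \<rho> / (real n * (1 - \<rho>)) * (\<rho> * real n * P (Suc s) / real (Suc s) - 1)"
      using Delta_closed_form[of \<rho> "Suc s" n] assms that unfolding Delta_def P_def by simp
    moreover have "\<rho> / (real n * (1 - \<rho>)) * x \<le> 0 \<longleftrightarrow> x \<le> 0" for x
      using mult_le_cancel_left_pos[OF fac, of x 0] by (simp only: mult_zero_right)
    ultimately have "Vseq n \<rho> (Suc s) - Vseq n \<rho> s \<le> 0
        \<longleftrightarrow> \<rho> * real n * P (Suc s) / real (Suc s) - 1 \<le> 0"
      by (simp only:)
    then show ?thesis by (simp add: divide_le_eq_1)
  qed
  have split: "P (Suc i) = (1 - \<rho> / real (Suc (Suc i))) * P (Suc (Suc i))"
    unfolding P_def
    using prod.atLeast_Suc_atMost[of "Suc (Suc i)" n "\<lambda>k. 1 - \<rho> / real k"] i by simp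
  have key: "(1 - \<rho> / real (Suc (Suc i))) * (\<rho> * real n * P (Suc (Suc i))) \<le> real (Suc i)"
    using le sgn[of i] i split by (simp add: mult_ac)
  have "\<rho> * real n * P (Suc (Suc i)) * (real (Suc (Suc i)) - \<rho>)
      \<le> real (Suc i) * real (Suc (Suc i))"
    using key by (simp add: field_simps)
  \<comment> \<open>This is where \<rho> < 1 enters: \<open>i + 1 \<le> i + 2 - \<rho>\<close>. The
    common positive factor \<open>i + 2 - \<rho>\<close> can then be cancelled.\<close>
  also have "\<dots> \<le> (real (Suc (Suc i)) - \<rho>) * real (Suc (Suc i))"
    using assms by (intro mult_right_mono) auto
  finally have "\<rho> * real n * P (Suc (Suc i)) \<le> real (Suc (Suc i))"
    using assms by (simp add: mult.commute)
  then show "Vseq n \<rho> (Suc (Suc i)) \<le> Vseq n \<rho> (Suc i)"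
    using sgn[of "Suc i"] i by simp
qed

section \<open>Asymptotics of the logarithm of the product\<close>

lemma ln_factor_expansion:
  fixes \<rho> :: real
  assumes "0 < \<rho>"
  shows "(\<lambda>k::nat. ln (1 - \<rho> / real (Suc k))
      - (\<rho> * ln (real k / real (Suc k)) + \<rho> * (1 - \<rho>) / 2 * (1 / real k - 1 / real (Suc k))))
    \<in> O(\<lambda>k. 1 / real k ^ 3)"
proof -
  \<comment> \<open>With \<open>Y = 1 / (k + 1)\<close>, the functions \<open>f\<close>,
    \<open>g\<close>, \<open>h\<close> are the remainders of \<open>ln (1 - \<rho> Y)\<close>,
    \<open>ln (k / (k + 1))\<close> and \<open>1/k - 1/(k + 1)\<close> after their terms up to order
    \<open>Y^2\<close>. The last two expressions telescope in \<open>k\<close>, and a combination of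
    them matches the first to second order.\<close>
  define f where "f k = ln (1 - \<rho> * (1 / real (Suc k))) + \<rho> * (1 / real (Suc k))
    + (\<rho> * (1 / real (Suc k)))\<^sup>2 / 2" for k :: nat
  define g where "g k = ln (real k / real (Suc k)) + 1 / real (Suc k)
    + (1 / real (Suc k))\<^sup>2 / 2" for k :: nat
  define h where "h k = 1 / real k - 1 / real (Suc k) - (1 / real (Suc k))\<^sup>2" for k :: nat
  have "(\<lambda>x::real. ln (1 - x) + x + x\<^sup>2 / 2) \<in> O[at_right 0](\<lambda>x. x ^ 3)"
    by real_asymp
  moreover have "filterlim (\<lambda>k::nat. \<rho> * (1 / real (Suc k))) (at_right 0) sequentially"
    using assms by real_asymp
  ultimately have "f \<in> O(\<lambda>k. (\<rho> * (1 / real (Suc k))) ^ 3)"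
    unfolding f_def by (rule landau_o.big.compose)
  also have "(\<lambda>k. (\<rho> * (1 / real (Suc k))) ^ 3) \<in> O(\<lambda>k::nat. 1 / real k ^ 3)"
    using assms by real_asymp
  finally have f: "f \<in> O(\<lambda>k. 1 / real k ^ 3)" .
  have g: "g \<in> O(\<lambda>k. 1 / real k ^ 3)" unfolding g_def by real_asymp
  have h: "h \<in> O(\<lambda>k. 1 / real k ^ 3)" unfolding h_def by real_asymp
  have scale: "(\<lambda>k. a * F k) \<in> O(\<lambda>k::nat. 1 / real k ^ 3)"
    if "F \<in> O(\<lambda>k. 1 / real k ^ 3)" for a :: real and F
    using that by (cases "a = 0") auto
  have "(\<lambda>k. f k - \<rho> * g k - \<rho> * (1 - \<rho>) / 2 * h k) \<in> O(\<lambda>k. 1 / real k ^ 3)"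
    by (rule sum_in_bigo(2)[OF sum_in_bigo(2)[OF f scale[OF g]] scale[OF h]])
  moreover have "f k - \<rho> * g k - \<rho> * (1 - \<rho>) / 2 * h k = ln (1 - \<rho> / real (Suc k))
      - (\<rho> * ln (real k / real (Suc k)) + \<rho> * (1 - \<rho>) / 2 * (1 / real k - 1 / real (Suc k)))" for k
  proof -
    \<comment> \<open>With the logarithms and \<open>1/k\<close> treated as unknowns, only powers of
      \<open>Y\<close> have to cancel; the coefficient of \<open>Y^2\<close> is
      \<open>\<rho>^2/2 - \<rho>/2 + \<rho>(1 - \<rho>)/2 = 0\<close>.\<close>
    have "(A + \<rho> * Y + (\<rho> * Y)\<^sup>2 / 2) - \<rho> * (B + Y + Y\<^sup>2 / 2)
        - \<rho> * (1 - \<rho>) / 2 * (X - Y - Y\<^sup>2)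
      = A - (\<rho> * B + \<rho> * (1 - \<rho>) / 2 * (X - Y))" for A B X Y :: real
      by (simp add: field_simps power2_eq_square)
    then show ?thesis unfolding f_def g_def h_def
      by (metis (no_types) mult_1_right times_divide_eq_right)
  qed
  ultimately show ?thesis by (simp only:)
qed

text \<open>Summing the one-factor estimate over \<open>k = r, ..., n - 1\<close> makes the main
  terms telescope, and each of the \<open>n - r\<close> errors is at most \<open>C / r^3\<close>.
  This crude total is already of order \<open>n^-2\<close> when \<open>r\<close> is comparable to
  \<open>n\<close>.\<close>

lemma ln_prod_expansion:
  fixes \<rho> :: real
  assumes "0 < \<rho>" "\<rho> < 1"
  obtains C r0 where "C \<ge> 0" "r0 \<ge> 1"
    "\<And>r n. r0 \<le> r \<Longrightarrow> r \<le> n \<Longrightarrow>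
      \<bar>ln (\<Prod>k=r+1..n. (1 - \<rho> / real k))
        - (\<rho> * ln (real r / real n) + \<rho> * (1 - \<rho>) / 2 * (1 / real r - 1 / real n))\<bar>
      \<le> C * (real n - real r) / real r ^ 3"
proof -
  define c where "c = \<rho> * (1 - \<rho>) / 2"
  from ln_factor_expansion[OF assms(1), folded c_def] obtain C where C: "C > 0"
    and "\<forall>\<^sub>F k in sequentially. \<bar>ln (1 - \<rho> / real (Suc k))
      - (\<rho> * ln (real k / real (Suc k)) + c * (1 / real k - 1 / real (Suc k)))\<bar> \<le> C / real k ^ 3"
    by (elim landau_o.bigE) (auto simp: power_abs)
  then obtain k0 where k0: "\<And>k. k \<ge> k0 \<Longrightarrow> \<bar>ln (1 - \<rho> / real (Suc k))
      - (\<rho> * ln (real k / real (Suc k)) + c * (1 / real k - 1 / real (Suc k)))\<bar> \<le> C / real k ^ 3"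
    unfolding eventually_sequentially by blast
  show thesis
  \<comment> \<open>Beyond \<open>k0\<close> the one-factor estimate holds pointwise; the 1 keeps
    \<open>r\<close> positive.\<close>
  proof (rule that[of C "max 1 k0"])
    fix r n :: nat
    assume r: "max 1 k0 \<le> r" and "r \<le> n"
    from \<open>r \<le> n\<close> show "\<bar>ln (\<Prod>k=r+1..n. (1 - \<rho> / real k))
        - (\<rho> * ln (real r / real n) + \<rho> * (1 - \<rho>) / 2 * (1 / real r - 1 / real n))\<bar>
      \<le> C * (real n - real r) / real r ^ 3"
      unfolding c_def[symmetric]
    proof (induction n rule: dec_induct)
      case base
      show ?case using r by simp
    next
      case (step n)
      let ?P = "\<Prod>k=r+1..n. (1 - \<rho> / real k)"
      have pos: "real r > 0" "real n > 0" using r step by auto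
      have "0 < 1 - \<rho> / real (Suc n)" using assms by (simp add: divide_less_eq)
      then have ln_split: "ln (?P * (1 - \<rho> / real (Suc n))) = ln ?P + ln (1 - \<rho> / real (Suc n))"
        using prod_pos_of_lt_one[OF assms(2), of r n] by (metis ln_mult less_irrefl)
      have err: "\<bar>ln (1 - \<rho> / real (Suc n))
          - (\<rho> * ln (real n / real (Suc n)) + c * (1 / real n - 1 / real (Suc n)))\<bar>
          \<le> C / real r ^ 3"
      proof -
        have "C / real n ^ 3 \<le> C / real r ^ 3"
          using C pos step by (intro divide_left_mono power_mono) auto
        then show ?thesis using k0[of n] r step by force
      qed
      have "ln (real r / real (Suc n)) = ln (real r / real n) + ln (real n / real (Suc n))"
        using pos by (simp add: ln_div)
      then have tel: "\<rho> * ln (real r / real (Suc n)) + c * (1 / real r - 1 / real (Suc n))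
          = (\<rho> * ln (real r / real n) + c * (1 / real r - 1 / real n))
          + (\<rho> * ln (real n / real (Suc n)) + c * (1 / real n - 1 / real (Suc n)))"
        by (simp add: algebra_simps)
      have prodS: "(\<Prod>k=r+1..Suc n. (1 - \<rho> / real k)) = ?P * (1 - \<rho> / real (Suc n))"
        using step by simp
      have rhs: "C * (real (Suc n) - real r) / real r ^ 3
          = C * (real n - real r) / real r ^ 3 + C / real r ^ 3"
        by (simp add: add_divide_distrib[symmetric] algebra_simps)
      show ?case
        unfolding prodS ln_split tel rhs using step.IH err by linarith
    qed
  qed (use C in auto)
qed

section \<open>Exponential form and expansion of the scaled differences\<close>

lemma abs_exp_minus_one_minus_le:
  fixes x :: real
  assumes "\<bar>x\<bar> \<le> 1"
  shows "\<bar>exp x - 1 - x\<bar> \<le> x\<^sup>2"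
proof -
  have "exp x \<le> 1 + x + x\<^sup>2"
  proof (cases "x \<ge> 0")
    case True
    then show ?thesis using exp_bound assms by auto
  next
    case False
    have "0 \<le> - x * x\<^sup>2" using False by (intro mult_nonneg_nonneg) auto
    \<comment> \<open>The product equals \<open>1 - x^3\<close>, which is at least 1 for negative
      \<open>x\<close>; then \<open>1 - x \<le> exp (- x)\<close> transfers the bound to the
      exponential.\<close>
    then have "1 \<le> (1 + x + x\<^sup>2) * (1 - x)"
      by (simp add: algebra_simps power2_eq_square)
    also have "\<dots> \<le> (1 + x + x\<^sup>2) * exp (- x)"
      using exp_ge_add_one_self[of "- x"] assms by (intro mult_left_mono) auto
    finally show ?thesis by (simp add: exp_minus field_simps)
  qed
  then show ?thesis using exp_ge_add_one_self[of x] by linarith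
qed

lemma ell_bounds:
  assumes "0 < \<rho>" "\<rho> < 1"
  shows "0 < ell \<rho>" "ell \<rho> < 1"
  using assms powr_less_mono2[of "1 / (1 - \<rho>)" \<rho> 1] by (auto simp: ell_def)

text \<open>Because \<open>\<rho> = ell^(1 - \<rho>)\<close>, the factor \<rho> is absorbed into the
  last logarithm. The grouping isolates two small quantities: the correction to \<open>ln P\<close>,
  and a logarithm vanishing at \<open>r = ell n\<close>.\<close>

lemma Dseq_exp_form:
  assumes \<rho>: "0 < \<rho>" "\<rho> < 1" and r: "1 \<le> r" "r \<le> n"
  shows "Dseq n \<rho> r = real n / (1 - \<rho>)
    * (exp (ln (\<Prod>k=r+1..n. (1 - \<rho> / real k)) - \<rho> * ln (real r / real n)
        - (1 - \<rho>) * ln (real r / (ell \<rho> * real n))) - 1)"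
proof -
  let ?P = "\<Prod>k=r+1..n. (1 - \<rho> / real k)"
  have pos: "real r > 0" "real n > 0" using r by auto
  have "ln (ell \<rho>) = ln \<rho> / (1 - \<rho>)"
    using \<rho> by (simp add: ell_def ln_powr)
  then have "(1 - \<rho>) * ln (ell \<rho>) = ln \<rho>" using \<rho> by simp
  then have "ln ?P - \<rho> * ln (real r / real n) - (1 - \<rho>) * ln (real r / (ell \<rho> * real n))
      = ln ?P + ln \<rho> + ln (real n) - ln (real r)"
    using pos ell_bounds[OF \<rho>] by (simp add: ln_div ln_mult algebra_simps)
  also have "exp \<dots> = \<rho> * real n * ?P / real r"
    using pos \<rho> prod_pos_of_lt_one[OF \<rho>(2), of r n]
    by (simp add: exp_add exp_diff)
  finally show ?thesis
    using Delta_closed_form[of \<rho> r n] \<rho> r pos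
    by (simp add: Dseq_def power2_eq_square)
qed

text \<open>In the window around \<open>ell n\<close> the exponent is
  \<open>y = L/n + O(n^-2)\<close>, so \<open>exp y - 1\<close> has the same expansion.
  Multiplication by \<open>n / (1 - \<rho>)\<close> turns \<open>L/n\<close> into the linear main
  term and the error into \<open>O(1/n)\<close>.\<close>

lemma Dseq_expansion:
  assumes \<rho>: "0 < \<rho>" "\<rho> < 1" and M: "M > 0"
  obtains K n0 where "\<And>n u r. n0 \<le> n \<Longrightarrow> \<bar>u\<bar> \<le> M \<Longrightarrow> real r = ell \<rho> * real n + u \<Longrightarrow>
      1 \<le> r \<Longrightarrow> r \<le> n \<Longrightarrow>
      \<bar>Dseq n \<rho> r - (- (1 / ell \<rho>) * (u - cconst \<rho>))\<bar> \<le> K / real n"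
proof -
  define l where "l = ell \<rho>"
  define c where "c = \<rho> * (1 - \<rho>) / 2"
  have l: "0 < l" "l < 1" using ell_bounds[OF \<rho>] by (auto simp: l_def)
  have c: "c > 0" using \<rho> by (simp add: c_def)
  from ln_prod_expansion[OF \<rho>, folded c_def] obtain C r0 where C: "C \<ge> 0" and r0: "r0 \<ge> 1"
    and lnP: "\<And>r n. r0 \<le> r \<Longrightarrow> r \<le> n \<Longrightarrow>
      \<bar>ln (\<Prod>k=r+1..n. (1 - \<rho> / real k))
        - (\<rho> * ln (real r / real n) + c * (1 / real r - 1 / real n))\<bar>
      \<le> C * (real n - real r) / real r ^ 3"
    by blast
  \<comment> \<open>\<open>K1\<close> adds the constants of the errors \<open>e1\<close>,
    \<open>e2\<close>, \<open>e3\<close> below, \<open>B\<close> bounds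
    \<open>n * \<bar>y\<bar>\<close>, and the \<open>B\<^sup>2\<close> in \<open>K\<close> pays for
    the quadratic remainder of the exponential.\<close>
  define K1 where "K1 = 2 * M\<^sup>2 / l\<^sup>2 + 2 * c * M / l\<^sup>2 + 8 * C / l ^ 3"
  define B where "B = M / l + c / l + K1"
  define K where "K = (K1 + B\<^sup>2) / (1 - \<rho>)"
  \<comment> \<open>The four bounds give, in turn: \<open>n\<close> positive;
    \<open>r \<ge> l n / 2\<close> and \<open>\<bar>w\<bar> \<le> 1/2\<close>;
    \<open>r \<ge> r0\<close>; and \<open>\<bar>y\<bar> \<le> 1\<close>.\<close>
  define n0 where "n0 = nat \<lceil>max (max 1 (2 * M / l)) (max (2 * real r0 / l) B)\<rceil>"
  show thesis
  proof (rule that[of n0 K])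
    fix n r :: nat and u :: real
    assume n0: "n0 \<le> n" and u: "\<bar>u\<bar> \<le> M" and r_eq: "real r = ell \<rho> * real n + u"
      and r: "1 \<le> r" "r \<le> n"
    have "max (max 1 (2 * M / l)) (max (2 * real r0 / l) B) \<le> real n"
      using n0 unfolding n0_def by linarith
    then have n: "1 \<le> real n" "2 * M / l \<le> real n" "2 * real r0 / l \<le> real n" "B \<le> real n"
      by auto
    have Mn: "2 * M \<le> l * real n" and r0n: "2 * real r0 \<le> l * real n"
      using n l by (auto simp: field_simps)
    have r_ge: "l * real n / 2 \<le> real r"
      using r_eq u Mn by (simp add: l_def abs_le_iff)
    have ln_pos: "0 < l * real n" and r_pos: "0 < real r" using l n r by auto
    define w where "w = u / (l * real n)"
    define y where "y = ln (\<Prod>k=r+1..n. (1 - \<rho> / real k)) - \<rho> * ln (real r / real n)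
        - (1 - \<rho>) * ln (real r / (l * real n))"
    \<comment> \<open>The coefficient of \<open>1/n\<close> in \<open>y\<close>: the first term
      comes from \<open>-(1 - \<rho>) w\<close>, the second from
      \<open>c / (l n) - c / n\<close>.\<close>
    define L where "L = - (1 - \<rho>) * u / l + c * (1 - l) / l"

    have w_abs: "\<bar>w\<bar> \<le> M / (l * real n)"
      unfolding w_def abs_divide using u ln_pos by (simp add: divide_right_mono)
    have w_half: "\<bar>w\<bar> \<le> 1 / 2"
    proof -
      have "M / (l * real n) \<le> 1 / 2" using Mn ln_pos by (simp add: field_simps)
      then show ?thesis using w_abs by linarith
    qed
    have "real r / (l * real n) = 1 + w"
      using r_eq l n by (simp add: w_def l_def[symmetric] add_divide_distrib)
    then have "\<bar>ln (real r / (l * real n)) - w\<bar> \<le> 2 * w\<^sup>2"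
      using abs_ln_one_plus_x_minus_x_bound[OF w_half] by simp
    also have "\<dots> \<le> 2 * (M / (l * real n))\<^sup>2"
      using power_mono[OF w_abs, of 2] by simp
    also have "\<dots> = 2 * M\<^sup>2 / l\<^sup>2 / (real n)\<^sup>2"
      by (simp add: power_divide power_mult_distrib)
    finally have e1: "\<bar>ln (real r / (l * real n)) - w\<bar> \<le> 2 * M\<^sup>2 / l\<^sup>2 / (real n)\<^sup>2" .
    have e2: "\<bar>c / real r - c / (l * real n)\<bar> \<le> 2 * c * M / l\<^sup>2 / (real n)\<^sup>2"
    proof -
      have "c / real r - c / (l * real n) = - c * u / (real r * (l * real n))"
        using r_eq r_pos l n by (simp add: l_def[symmetric] field_simps)
      then have "\<bar>c / real r - c / (l * real n)\<bar> = c * \<bar>u\<bar> / (real r * (l * real n))"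
        using c r_pos l n by (simp add: abs_mult)
      also have "\<dots> \<le> c * M / ((l * real n / 2) * (l * real n))"
        using c u r_pos l n r_ge M
        by (intro frac_le mult_left_mono mult_right_mono mult_nonneg_nonneg mult_pos_pos) auto
      also have "\<dots> = 2 * c * M / l\<^sup>2 / (real n)\<^sup>2"
        by (simp add: power2_eq_square mult_ac)
      finally show ?thesis .
    qed
    have e3: "\<bar>ln (\<Prod>k=r+1..n. (1 - \<rho> / real k))
        - (\<rho> * ln (real r / real n) + c * (1 / real r - 1 / real n))\<bar> \<le> 8 * C / l ^ 3 / (real n)\<^sup>2"
    proof -
      have "real r0 \<le> real r" using r_ge r0n by linarith
      then have "\<bar>ln (\<Prod>k=r+1..n. (1 - \<rho> / real k))
        - (\<rho> * ln (real r / real n) + c * (1 / real r - 1 / real n))\<bar>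
        \<le> C * (real n - real r) / real r ^ 3"
        using lnP[of r n] r by simp
      \<comment> \<open>At most \<open>n\<close> factors, each with error of order
        \<open>n^-3\<close> since \<open>r \<ge> l n / 2\<close>.\<close>
      also have "\<dots> \<le> C * real n / (l * real n / 2) ^ 3"
        using C r_pos l n r_ge r
        by (intro frac_le mult_left_mono power_mono zero_less_power mult_nonneg_nonneg) auto
      also have "\<dots> = 8 * C / l ^ 3 / (real n)\<^sup>2"
        using n l by (simp add: field_simps power2_eq_square power3_eq_cube)
      finally show ?thesis .
    qed
    have yL: "\<bar>y - L / real n\<bar> \<le> K1 / (real n)\<^sup>2"
    proof -
      \<comment> \<open>The error \<open>y - L/n\<close> splits exactly into
        \<open>a + b - (1 - \<rho>) q\<close>, whose parts are controlled by \<open>e3\<close>,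
        \<open>e2\<close> and \<open>e1\<close>.\<close>
      define q where "q = ln (real r / (l * real n)) - w"
      define a where "a = ln (\<Prod>k=r+1..n. (1 - \<rho> / real k))
        - (\<rho> * ln (real r / real n) + c * (1 / real r - 1 / real n))"
      define b where "b = c / real r - c / (l * real n)"
      have "\<bar>(1 - \<rho>) * q\<bar> \<le> 1 * \<bar>q\<bar>"
        unfolding abs_mult using \<rho> by (intro mult_right_mono) auto
      then have "\<bar>a + b - (1 - \<rho>) * q\<bar> \<le> \<bar>a\<bar> + \<bar>b\<bar> + \<bar>q\<bar>"
        using abs_triangle_ineq[of a b] abs_triangle_ineq4[of "a + b" "(1 - \<rho>) * q"] by simp
      also have "\<dots> \<le> 8 * C / l ^ 3 / (real n)\<^sup>2 + 2 * c * M / l\<^sup>2 / (real n)\<^sup>2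
          + 2 * M\<^sup>2 / l\<^sup>2 / (real n)\<^sup>2"
        using e1 e2 e3 unfolding a_def b_def q_def by (intro add_mono)
      also have "\<dots> = K1 / (real n)\<^sup>2"
        by (simp add: K1_def add_divide_distrib)
      also have "a + b - (1 - \<rho>) * q = y - L / real n"
        unfolding a_def b_def q_def y_def L_def w_def using l n r_pos
        by (simp add: field_simps)
      finally show ?thesis .
    qed
    have K1: "K1 \<ge> 0" using C c M l by (simp add: K1_def)
    have "\<bar>L\<bar> \<le> M / l + c / l"
    proof -
      have "\<bar>- (1 - \<rho>) * u\<bar> \<le> 1 * M"
        unfolding abs_mult using \<rho> u by (intro mult_mono) auto
      then have "\<bar>- (1 - \<rho>) * u / l\<bar> \<le> M / l"
        using l by (simp add: abs_divide divide_right_mono)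
      moreover have "\<bar>c * (1 - l) / l\<bar> \<le> c / l"
        using l c by (simp add: divide_right_mono abs_mult)
      ultimately show ?thesis unfolding L_def by linarith
    qed
    moreover have "\<bar>y\<bar> \<le> (\<bar>L\<bar> + K1) / real n"
    proof -
      have "K1 / (real n)\<^sup>2 \<le> K1 / real n"
        using K1 n by (intro divide_left_mono) (auto simp: power2_eq_square)
      moreover have "\<bar>L / real n\<bar> = \<bar>L\<bar> / real n" by simp
      ultimately show ?thesis using yL unfolding add_divide_distrib by linarith
    qed
    moreover have "(\<bar>L\<bar> + K1) / real n \<le> B / real n" if "\<bar>L\<bar> \<le> M / l + c / l"
      using that n by (intro divide_right_mono) (auto simp: B_def)
    ultimately have yB: "\<bar>y\<bar> \<le> B / real n" by linarith
    also have "B / real n \<le> 1" using n by simp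
    finally have "\<bar>y\<bar> \<le> 1" .
    then have "\<bar>exp y - 1 - y\<bar> \<le> y\<^sup>2" by (rule abs_exp_minus_one_minus_le)
    also have "y\<^sup>2 \<le> B\<^sup>2 / (real n)\<^sup>2"
      using power_mono[OF yB, of 2] by (simp add: power_divide)
    \<comment> \<open>The error is the sum of \<open>exp y - 1 - y\<close> and
      \<open>y - L/n\<close>.\<close>
    finally have expL: "\<bar>exp y - 1 - L / real n\<bar> \<le> (K1 + B\<^sup>2) / (real n)\<^sup>2"
      using yL unfolding add_divide_distrib by linarith
    \<comment> \<open>Dividing by \<open>1 - \<rho>\<close> turns \<open>c\<close> into
      \<open>\<rho> / 2\<close>, which produces the constant \<open>cconst\<close>.\<close>
    have "- (1 / l) * (u - cconst \<rho>) = L / (1 - \<rho>)"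
      using \<rho> l by (simp add: L_def c_def cconst_def l_def[symmetric] field_simps)
    moreover have "Dseq n \<rho> r = real n / (1 - \<rho>) * (exp y - 1)"
      using Dseq_exp_form[OF \<rho> r] by (simp only: y_def l_def)
    ultimately have "Dseq n \<rho> r - (- (1 / l) * (u - cconst \<rho>))
        = real n / (1 - \<rho>) * (exp y - 1 - L / real n)"
      using n by (simp only: right_diff_distrib) simp
    then have "\<bar>Dseq n \<rho> r - (- (1 / l) * (u - cconst \<rho>))\<bar>
        = real n / (1 - \<rho>) * \<bar>exp y - 1 - L / real n\<bar>"
      using n \<rho> by (simp add: abs_mult)
    also have "\<dots> \<le> real n / (1 - \<rho>) * ((K1 + B\<^sup>2) / (real n)\<^sup>2)"
      using expL n \<rho> by (intro mult_left_mono) auto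
    also have "\<dots> = K / real n"
      using n by (simp add: K_def power2_eq_square)
    finally show "\<bar>Dseq n \<rho> r - (- (1 / ell \<rho>) * (u - cconst \<rho>))\<bar> \<le> K / real n"
      unfolding l_def .
  qed
qed

theorem mainTheorem6:
  fixes \<rho> :: real
  assumes "0 < \<rho>" and "\<rho> < 1"
  shows "(\<forall>n\<ge>1. unimodal n (Vseq n \<rho>))
    \<and> 0 < cconst \<rho> \<and> cconst \<rho> < 1 / 2
    \<and> (\<forall>M>0. \<exists>(K::real) (n0::nat). \<forall>n\<ge>n0. \<forall>(u::real) (r::nat).
          \<bar>u\<bar> \<le> M \<and> real r = ell \<rho> * real n + u \<and> 1 \<le> r \<and> r \<le> n \<longrightarrow>
          \<bar>Dseq n \<rho> r - (- (1 / ell \<rho>) * (u - cconst \<rho>))\<bar> \<le> K / real n)"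
proof (intro conjI allI impI)
  have "\<rho> * (1 - ell \<rho>) < 1 * 1"
    using assms ell_bounds[OF assms] by (intro mult_strict_mono) auto
  then show "cconst \<rho> < 1 / 2" by (simp add: cconst_def)
  show "0 < cconst \<rho>" using assms ell_bounds[OF assms] by (simp add: cconst_def)
next
  fix M :: real assume "M > 0"
  from Dseq_expansion[OF assms this] show "\<exists>(K::real) (n0::nat). \<forall>n\<ge>n0. \<forall>(u::real) (r::nat).
      \<bar>u\<bar> \<le> M \<and> real r = ell \<rho> * real n + u \<and> 1 \<le> r \<and> r \<le> n \<longrightarrow>
      \<bar>Dseq n \<rho> r - (- (1 / ell \<rho>) * (u - cconst \<rho>))\<bar> \<le> K / real n"
    by metis
qed (rule unimodal_Vseq[OF assms])

end
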